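(* Let $P\subseteq\mathbb{R}^n$ be a compact convex set with diameter $D$, and let $f$ be an $L$-smooth and convex function on the $D$-neighborhood of $P$. Let $x_t,v_t\in P$ with $x_t\neq v_t$ and $\langle\nabla f(x_t),x_t-v_t\rangle\ge 0$. Further, let $$x_{t+1}=(1-\gamma_t)x_t+\gamma_t v_t\qquad\text{with}\qquad \gamma_t=\min\left\{\frac{\langle\nabla f(x_t),x_t-v_t\rangle}{M\|x_t-v_t\|^2},\,1\right\}$$ for some $M>0$. If $\langle\nabla f(x_{t+1}),x_t-v_t\rangle\ge 0$, then $$f(x_t)-f(x_{t+1})\ \ge\ \frac{\langle\nabla f(x_t),x_t-v_t\rangle^2+\langle\nabla f(x_{t+1}),x_t-v_t\rangle^2}{2\max\{L,M\}\,\|x_t-v_t\|^2}\qquad\text{if }\gamma_t\in[0,1],$$ and $$f(x_t)-f(x_{t+1})\ \ge\ \frac{\langle\nabla f(x_t),x_t-v_t\rangle}{2}+\frac{\langle\nabla f(x_{t+1}),x_t-v_t\rangle^2}{2\langle\nabla f(x_t),x_t-v_t\rangle}\ \ge\ \frac{\langle\nabla f(x_t),x_t-v_t\rangle}{2}\qquad\text{if }\gamma_t=1\text{ and }M\ge L.$$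
   Context: $\|\cdot\|$ is the Euclidean norm and $\langle\cdot,\cdot\rangle$ the standard inner product on $\mathbb{R}^n$. The diameter of $P$ is $D=\max_{x,y\in P}\|x-y\|$. The $D$-neighborhood of $P$ is the set of points of $\mathbb{R}^n$ at distance at most $D$ from $P$. Functions are assumed differentiable. A differentiable function $f$ is $L$-smooth on a convex set $Q$ if $f(y)-f(x)\le\langle\nabla f(x),y-x\rangle+\frac{L}{2}\|y-x\|^2$ for all $x,y\in Q$, and convex on $Q$ if $f(y)-f(x)\ge\langle\nabla f(x),y-x\rangle$ for all $x,y\in Q$.
   Formalization: The first inequality is stated when the unclipped ratio ⟨∇f(x_t),x_t−v_t⟩/(M‖x_t−v_t‖²) lies in [0,1], not merely γ_t∈[0,1], which always holds; with the ratio above 1 it can fail: P=[0,1], f(z)=2z, x_t=1, v_t=0, L=M=1. *)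

theory Defs
  imports "HOL-Analysis.Analysis"
begin

definition neighborhood :: "real \<Rightarrow> 'a::metric_space set \<Rightarrow> 'a set" where
  "neighborhood D P = {x. infdist x P \<le> D}"

text \<open>
  The derivative is taken relative to \<open>Q\<close>, so that a function given only on \<open>Q\<close> is covered.
  For convex \<open>Q\<close> with nonempty interior this determines the gradient at every point of \<open>Q\<close>, and
  it is the ordinary gradient wherever \<open>f\<close> is differentiable in the full sense.
\<close>

definition is_gradient_on :: "('a::real_inner \<Rightarrow> real) \<Rightarrow> ('a \<Rightarrow> 'a) \<Rightarrow> 'a set \<Rightarrow> bool" where
  "is_gradient_on f grad Q \<longleftrightarrow>
     (\<forall>x\<in>Q. (f has_derivative (\<lambda>h. grad x \<bullet> h)) (at x within Q))"

definition smooth_on_with ::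
    "real \<Rightarrow> ('a::real_inner \<Rightarrow> real) \<Rightarrow> ('a \<Rightarrow> 'a) \<Rightarrow> 'a set \<Rightarrow> bool" where
  "smooth_on_with L f grad Q \<longleftrightarrow>
     (\<forall>x\<in>Q. \<forall>y\<in>Q. f y - f x \<le> grad x \<bullet> (y - x) + L / 2 * (norm (y - x))\<^sup>2)"

definition convex_on_with ::
    "('a::real_inner \<Rightarrow> real) \<Rightarrow> ('a \<Rightarrow> 'a) \<Rightarrow> 'a set \<Rightarrow> bool" where
  "convex_on_with f grad Q \<longleftrightarrow>
     (\<forall>x\<in>Q. \<forall>y\<in>Q. f y - f x \<ge> grad x \<bullet> (y - x))"

end

(* Put d = x - v, a = grad x . d, b = grad x' . d, and evaluate f at the auxiliary point
   z = x - s d with s = (a - b) / C. Smoothness at x bounds f z from above, convexity at x' bounds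
   it from below, and together they give f x - f x' >= (a^2 + b^2) / (2 C) whenever C dominates
   both a and L |d|^2 and the step size is at least a / C. Both claims are instances:
   C = max L M |d|^2 for the first, C = a for the second. Since 0 <= s <= 1, the point z lies on
   the segment from x to v. *)

theory Submission
  imports Defs
begin

lemma convex_on_with_gradient_monotone:
  assumes "convex_on_with f grad Q" "x \<in> Q" "y \<in> Q"
  shows "grad y \<bullet> (x - y) \<le> grad x \<bullet> (x - y)"
proof -
  have "f y - f x \<ge> grad x \<bullet> (y - x)" "f x - f y \<ge> grad y \<bullet> (x - y)"
    using assms unfolding convex_on_with_def by blast+
  then show ?thesis
    by (simp add: inner_diff_right)
qed

text \<open>Each bound on \<open>C\<close> has its own job: \<open>a \<le> C\<close> keeps
  \<open>z\<close> on the segment, \<open>L * (norm (x - v))\<^sup>2 \<le> C\<close> absorbs the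
  quadratic error of smoothness, and \<open>step\<close> makes \<open>\<gamma> * b\<close> at least
  \<open>a * b / C\<close>. Leaving \<open>C\<close> free lets one argument serve both
  claims.\<close>

lemma smooth_convex_descent:
  fixes f :: "'a::real_inner \<Rightarrow> real" and grad :: "'a \<Rightarrow> 'a" and x v :: 'a and \<gamma> C :: real
  defines "a \<equiv> grad x \<bullet> (x - v)"
    and "b \<equiv> grad (x - \<gamma> *\<^sub>R (x - v)) \<bullet> (x - v)"
  assumes "convex Q" "x \<in> Q" "v \<in> Q"
    and smooth: "smooth_on_with L f grad Q"
    and conv: "convex_on_with f grad Q"
    and \<gamma>: "0 \<le> \<gamma>" "\<gamma> \<le> 1"
    and "0 \<le> b"
    and C: "0 < C" "a \<le> C" "L * (norm (x - v))\<^sup>2 \<le> C"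
    and step: "a / C \<le> \<gamma>"
  shows "(a\<^sup>2 + b\<^sup>2) / (2 * C) \<le> f x - f (x - \<gamma> *\<^sub>R (x - v))"
proof -
  define N where "N = (norm (x - v))\<^sup>2"
  define y where "y = x - \<gamma> *\<^sub>R (x - v)"
  \<comment> \<open>This \<open>s\<close> maximizes \<open>s * (a - b) - s\<^sup>2 * C / 2\<close>,
    the part depending on \<open>s\<close> of the lower bound on the decrease obtained
    below.\<close>
  define s where "s = (a - b) / C"
  define z where "z = x - s *\<^sub>R (x - v)"
  have segment: "x - t *\<^sub>R (x - v) \<in> Q" if "0 \<le> t" "t \<le> 1" for t
  proof -
    have "(1 - t) *\<^sub>R x + t *\<^sub>R v \<in> Q"
      using assms that by (intro convexD_alt) auto
    then show ?thesis by (simp add: algebra_simps)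
  qed
  have "y \<in> Q"
    unfolding y_def using \<gamma> by (rule segment)
  have "b \<le> a"
  \<comment> \<open>For \<open>\<gamma> = 0\<close> the points \<open>x\<close> and \<open>y\<close>
    coincide. Otherwise \<open>x - y\<close> is a positive multiple of \<open>x - v\<close>, so
    gradient monotonicity can be divided by \<open>\<gamma>\<close>.\<close>
  proof (cases "\<gamma> = 0")
    case True
    then show ?thesis by (simp add: a_def b_def)
  next
    case False
    have "\<gamma> * b \<le> \<gamma> * a"
      using convex_on_with_gradient_monotone[OF conv \<open>x \<in> Q\<close> \<open>y \<in> Q\<close>]
      by (simp add: y_def a_def b_def)
    then show ?thesis using False \<gamma> by simp
  qed
  then have "0 \<le> s" "s \<le> 1"
    using C \<open>0 \<le> b\<close> by (auto simp: s_def)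
  then have "z \<in> Q"
    unfolding z_def by (rule segment)
  have "f z - f x \<le> grad x \<bullet> (z - x) + L / 2 * (norm (z - x))\<^sup>2"
    using smooth \<open>x \<in> Q\<close> \<open>z \<in> Q\<close> unfolding smooth_on_with_def by blast
  then have upper: "f z - f x \<le> - s * a + s\<^sup>2 * (L * N) / 2"
    by (simp add: z_def a_def N_def power_mult_distrib mult_ac)
  have "grad y \<bullet> (z - y) \<le> f z - f y"
    using conv \<open>y \<in> Q\<close> \<open>z \<in> Q\<close> unfolding convex_on_with_def by blast
  moreover have "z - y = (\<gamma> - s) *\<^sub>R (x - v)"
    by (simp add: z_def y_def algebra_simps)
  ultimately have lower: "(\<gamma> - s) * b \<le> f z - f y"
    by (simp add: b_def y_def)
  have "s\<^sup>2 * (L * N) \<le> s\<^sup>2 * C"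
    using C by (intro mult_left_mono) (auto simp: N_def)
  moreover have "a / C * b \<le> \<gamma> * b"
    using step \<open>0 \<le> b\<close> by (rule mult_right_mono)
  \<comment> \<open>At the maximizing \<open>s\<close> the last two terms equal
    \<open>(a - b)\<^sup>2 / (2 * C)\<close>; adding \<open>a * b / C\<close> cancels the cross
    term.\<close>
  moreover have "(a\<^sup>2 + b\<^sup>2) / (2 * C) = a / C * b + s * (a - b) - s\<^sup>2 * C / 2"
    using C by (simp add: s_def field_simps power2_eq_square)
  ultimately show ?thesis
    using upper lower unfolding y_def by (simp add: algebra_simps)
qed

lemma subset_neighborhood:
  assumes "0 \<le> D"
  shows "P \<subseteq> neighborhood D P"
  using assms by (auto simp: neighborhood_def)

theorem lemma4p10:
  fixes P :: "(real ^ 'n) set"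
    and f :: "real ^ 'n \<Rightarrow> real"
    and grad :: "real ^ 'n \<Rightarrow> real ^ 'n"
    and x v x' :: "real ^ 'n"
    and D L M \<gamma> :: real
  assumes "compact P" and "convex P" and "D = diameter P"
    and "is_gradient_on f grad (neighborhood D P)"
    and "smooth_on_with L f grad (neighborhood D P)"
    and "convex_on_with f grad (neighborhood D P)"
    and "x \<in> P" and "v \<in> P" and "x \<noteq> v"
    and "grad x \<bullet> (x - v) \<ge> 0"
    and "M > 0"
    and "\<gamma> = min ((grad x \<bullet> (x - v)) / (M * (norm (x - v))\<^sup>2)) 1"
    and "x' = (1 - \<gamma>) *\<^sub>R x + \<gamma> *\<^sub>R v"
    and "grad x' \<bullet> (x - v) \<ge> 0"
  shows "((grad x \<bullet> (x - v)) / (M * (norm (x - v))\<^sup>2) \<in> {0..1} \<longrightarrow>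
           f x - f x' \<ge> ((grad x \<bullet> (x - v))\<^sup>2 + (grad x' \<bullet> (x - v))\<^sup>2)
                          / (2 * max L M * (norm (x - v))\<^sup>2))
       \<and> (\<gamma> = 1 \<and> M \<ge> L \<longrightarrow>
           f x - f x' \<ge> (grad x \<bullet> (x - v)) / 2
                          + (grad x' \<bullet> (x - v))\<^sup>2 / (2 * (grad x \<bullet> (x - v)))
         \<and> (grad x \<bullet> (x - v)) / 2 + (grad x' \<bullet> (x - v))\<^sup>2 / (2 * (grad x \<bullet> (x - v)))
             \<ge> (grad x \<bullet> (x - v)) / 2)"
proof -
  define N where "N = (norm (x - v))\<^sup>2"
  define a where "a = grad x \<bullet> (x - v)"
  define b where "b = grad x' \<bullet> (x - v)"
  have "0 < N"
    using \<open>x \<noteq> v\<close> by (simp add: N_def)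
  have "0 \<le> a" "0 \<le> b"
    using assms by (simp_all add: a_def b_def)
  have \<gamma>: "\<gamma> = min (a / (M * N)) 1"
    using assms by (simp add: a_def N_def)
  have "0 \<le> \<gamma>" "\<gamma> \<le> 1"
    using \<open>0 \<le> a\<close> \<open>0 < N\<close> \<open>M > 0\<close> by (auto simp: \<gamma>)
  have x': "x' = x - \<gamma> *\<^sub>R (x - v)"
    using assms by (simp add: algebra_simps)
  have "P \<subseteq> neighborhood D P"
    using assms by (intro subset_neighborhood) (simp add: compact_imp_bounded diameter_ge_0)
  then have smooth: "smooth_on_with L f grad P" and conv: "convex_on_with f grad P"
    using assms unfolding smooth_on_with_def convex_on_with_def by blast+
  have descent: "(a\<^sup>2 + b\<^sup>2) / (2 * C) \<le> f x - f x'"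
    if "0 < C" "a \<le> C" "L * N \<le> C" "a / C \<le> \<gamma>" for C
    using smooth_convex_descent[OF \<open>convex P\<close> \<open>x \<in> P\<close> \<open>v \<in> P\<close> smooth conv
        \<open>0 \<le> \<gamma>\<close> \<open>\<gamma> \<le> 1\<close>, of C] that \<open>0 \<le> b\<close>
    by (simp add: a_def b_def N_def x')
  \<comment> \<open>The premise concerns the ratio before clipping at 1, so here
    \<open>\<gamma>\<close> equals that ratio. Enlarging \<open>M\<close> to \<open>max L M\<close>
    only lowers the step size that the descent bound requires.\<close>
  have first: "(a\<^sup>2 + b\<^sup>2) / (2 * max L M * N) \<le> f x - f x'" if "a / (M * N) \<le> 1"
  proof -
    have "M * N \<le> max L M * N" "L * N \<le> max L M * N"
      using \<open>0 < N\<close> by (auto intro!: mult_right_mono)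
    moreover have "0 < M * N" "a \<le> M * N" "\<gamma> = a / (M * N)"
      using that \<open>0 < N\<close> \<open>M > 0\<close> by (auto simp: \<gamma>)
    moreover from calculation have "a / (max L M * N) \<le> a / (M * N)"
      using \<open>0 \<le> a\<close> by (intro divide_left_mono) auto
    ultimately show ?thesis
      using descent[of "max L M * N"] by (simp add: mult.assoc)
  qed
  \<comment> \<open>A full step forces \<open>M * N \<le> a\<close>, hence \<open>0 < a\<close> and
    \<open>L * N \<le> a\<close>. So \<open>C = a\<close> is admissible, with
    \<open>a / C = 1 = \<gamma>\<close>.\<close>
  have second: "a / 2 + b\<^sup>2 / (2 * a) \<le> f x - f x'" if "\<gamma> = 1" "L \<le> M"
  proof -
    have "0 < M * N"
      using \<open>0 < N\<close> \<open>M > 0\<close> by simp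
    moreover have "1 \<le> a / (M * N)"
      using that \<gamma> by linarith
    ultimately have "M * N \<le> a"
      by (simp add: le_divide_eq)
    moreover have "L * N \<le> M * N"
      using that \<open>0 < N\<close> by (intro mult_right_mono) auto
    ultimately have "(a\<^sup>2 + b\<^sup>2) / (2 * a) \<le> f x - f x'"
      using \<open>0 < M * N\<close> that by (intro descent) simp_all
    moreover have "(a\<^sup>2 + b\<^sup>2) / (2 * a) = a / 2 + b\<^sup>2 / (2 * a)"
      using \<open>0 < M * N\<close> \<open>M * N \<le> a\<close> by (simp add: field_simps power2_eq_square)
    ultimately show ?thesis by simp
  qed
  \<comment> \<open>This covers \<open>a = 0\<close> as well, where the quotient is 0 by the
    convention for division by zero.\<close>
  have "a / 2 \<le> a / 2 + b\<^sup>2 / (2 * a)"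
    using \<open>0 \<le> a\<close> by simp
  with first second show ?thesis
    unfolding a_def b_def N_def by simp
qed

end
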